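(* Let $d\ge1$ and $p\ge1$ be integers, with no assumed relationship between $d$ and $p$. If the $d$-dimensional orthonormal Legendre polynomials of total order at most $p$ are sampled according to the $d$-dimensional Chebyshev distribution, with $\psi_k(\bm{\xi})$ weighted by the normalized weight function proportional to $\prod_{i=1}^d(1-\xi_i^2)^{1/4}$, then the coherence parameter satisfies $$\mu(\bm{Y})\le 3^d.$$
   Context: For a multi-index $\bm{k}=(k_1,\dots,k_d)$ of nonnegative integers set $\psi_{\bm{k}}(\bm{\xi})=\prod_{i=1}^d\psi_{k_i}(\xi_i)$, where $\psi_j$ is the univariate Legendre polynomial of degree $j$ normalized to be orthonormal with respect to the uniform probability density $1/2$ on $[-1,1]$. The polynomials of total order at most $p$ are those with $\|\bm{k}\|_1\le p$; there are $P=\binom{p+d}{d}$ of them, indexed also as $\psi_1,\dots,\psi_P$. The $d$-dimensional Chebyshev distribution on $[-1,1]^d$ has independent coordinates, each with density $\frac{1}{\pi\sqrt{1-\xi^2}}$; $\bm{Y}$ denotes a vector with this distribution. Weight normalization: with $f=2^{-d}$ on $\mathcal{S}=[-1,1]^d$, $G(\bm{\xi})=\prod_{i=1}^d(1-\xi_i^2)^{-1/4}$ and $c=\big(\int_{\mathcal{S}}fG^2\,d\bm{\xi}\big)^{-1/2}$, the density of $\bm{Y}$ is $c^2fG^2$ and the weight is $w=1/(cG)$, i.e. $w(\bm{\xi})=(\pi/2)^{d/2}\prod_{i=1}^d(1-\xi_i^2)^{1/4}$, so that $\{w(\bm{Y})\psi_k(\bm{Y})\}_{k=1}^P$ are orthonormal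 random variables. The coherence parameter is $\mu(\bm{Y}):=\sup_{k=1,\dots,P,\ \bm{\xi}\in[-1,1]^d}|w(\bm{\xi})\psi_k(\bm{\xi})|^2$. *)

theory Defs
  imports "HOL-Probability.Probability" "HOL-Computational_Algebra.Polynomial"
begin

text \<open>Rodrigues' formula; \<open>[:-1, 0, 1:]\<close> is the polynomial $x^2 - 1$.\<close>

definition legendre :: "nat \<Rightarrow> real poly" where
  "legendre j = smult (1 / (2 ^ j * fact j)) ((pderiv ^^ j) ([:-1, 0, 1:] ^ j))"

text \<open>Legendre polynomial with unit norm for the uniform probability density \<open>1/2\<close> on $[-1,1]$.\<close>

definition legendre_on :: "nat \<Rightarrow> real \<Rightarrow> real" where
  "legendre_on j x =
     poly (legendre j) x / sqrt (LINT t:{-1..1}|lborel. (poly (legendre j) t)\<^sup>2 * (1 / 2))"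

definition legendre_multi :: "nat ^ 'd::finite \<Rightarrow> real ^ 'd \<Rightarrow> real" where
  "legendre_multi k \<xi> = (\<Prod>i\<in>UNIV. legendre_on (k $ i) (\<xi> $ i))"

definition total_order :: "nat \<Rightarrow> (nat ^ 'd::finite) set" where
  "total_order p = {k. (\<Sum>i\<in>UNIV. k $ i) \<le> p}"

definition hypercube :: "(real ^ 'd::finite) set" where
  "hypercube = {\<xi>. \<forall>i. \<xi> $ i \<in> {-1..1}}"

definition chebyshev_density :: "real \<Rightarrow> real" where
  "chebyshev_density x = indicator {-1<..<1} x * (1 / (pi * sqrt (1 - x\<^sup>2)))"

definition chebyshev_distributed :: "'a measure \<Rightarrow> ('a \<Rightarrow> real ^ 'd::finite) \<Rightarrow> bool" where
  "chebyshev_distributed M Y \<longleftrightarrow>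
     prob_space.indep_vars M (\<lambda>_. borel) (\<lambda>i \<omega>. Y \<omega> $ i) UNIV \<and>
     (\<forall>i. distributed M lborel (\<lambda>\<omega>. Y \<omega> $ i) (\<lambda>x. ennreal (chebyshev_density x)))"

definition uniform_dens :: "real ^ 'd::finite \<Rightarrow> real" where
  "uniform_dens \<xi> = 1 / 2 ^ CARD('d)"

definition env :: "real ^ 'd::finite \<Rightarrow> real" where
  "env \<xi> = (\<Prod>i\<in>UNIV. (1 - (\<xi> $ i)\<^sup>2) powr (- 1 / 4))"

definition norm_const :: "'d::finite itself \<Rightarrow> real" where
  "norm_const _ =
     (LINT \<xi>:(hypercube :: (real ^ 'd) set)|lborel. uniform_dens \<xi> * (env \<xi>)\<^sup>2) powr (- 1 / 2)"

text \<open>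
  The vector \<open>Y\<close> of the Chebyshev distribution has density \<open>c\<^sup>2 * f * G\<^sup>2\<close> on the cube, where
  \<open>f\<close> is \<open>uniform_dens\<close>, \<open>G\<close> is \<open>env\<close> and \<open>c\<close> is \<open>norm_const\<close>.  On the boundary of the cube,
  where \<open>G\<close> is infinite, the conventions \<open>0 powr a = 0\<close> and \<open>1 / 0 = 0\<close> give the weight the
  intended value \<open>0\<close>.
\<close>

definition weight :: "real ^ 'd::finite \<Rightarrow> real" where
  "weight \<xi> = 1 / (norm_const TYPE('d) * env \<xi>)"

text \<open>
  The coherence depends on the sampling vector only through its weight function.  The supremum
  is taken in the extended reals, so that an upper bound on it includes boundedness.
\<close>

definition coherence :: "(real ^ 'd::finite \<Rightarrow> real) \<Rightarrow> nat \<Rightarrow> ereal" where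
  "coherence w p =
     (SUP (k, \<xi>) \<in> total_order p \<times> hypercube. ereal (\<bar>w \<xi> * legendre_multi k \<xi>\<bar>\<^sup>2))"

end

theory Submission imports Defs begin

text \<open>
  The weighted polynomial is a product over the coordinates, because the constant \<open>c\<close> splits off
  one factor for each coordinate: the integral of \<open>f G\<^sup>2\<close> over the cube is \<open>(\<pi> / 2) ^ d\<close>, since the
  one-dimensional Chebyshev density, being the density of a coordinate of \<open>Y\<close>, has total mass \<open>1\<close>
  (\<open>weight_square\<close>).  So it suffices to bound each factor
  \<open>\<pi> / 2 * sqrt (1 - x\<^sup>2) * \<psi>\<^sub>n(x)\<^sup>2\<close> by \<open>3\<close>, uniformly in the degree \<open>n\<close>.

  Let \<open>P\<close> be the Legendre polynomial of degree \<open>n\<close>.  As \<open>\<psi>\<^sub>n\<^sup>2 = (2n + 1) P\<^sup>2\<close>, what is needed is a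
  Bernstein inequality: \<open>(2n + 1) sqrt (1 - x\<^sup>2) P(x)\<^sup>2\<close> is bounded uniformly in \<open>n\<close> and \<open>x\<close>.  The proof
  is Sonin's.  With \<open>x = cos \<theta>\<close>, the function \<open>u(\<theta>) = sqrt (sin \<theta>) P(cos \<theta>)\<close> solves \<open>u'' + q u = 0\<close>
  with \<open>q = (n + 1/2)\<^sup>2 + 1 / (4 sin\<^sup>2 \<theta>)\<close>, and \<open>u\<^sup>2 + u'\<^sup>2 / q\<close> has derivative \<open>- q' u'\<^sup>2 / q\<^sup>2\<close>.  As \<open>q\<close>
  decreases up to \<open>\<theta> = \<pi> / 2\<close> and increases from there on, this expression, which dominates \<open>u\<^sup>2\<close>, is largest there, that is, at
  \<open>x = 0\<close> (\<open>sonin_le_sonin_0\<close>).  At \<open>0\<close> the values of \<open>P\<close> and \<open>P'\<close> are given by central binomial coefficients,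
  and the elementary bound \<open>(C(2m, m) / 4 ^ m)\<^sup>2 \<le> 1 / (3m + 1)\<close> gives the constant \<open>3 / 2\<close>
  (\<open>sonin_0_le\<close>).  The best constant is \<open>4 / \<pi>\<close>, but \<open>\<pi> / 2 * 3 / 2 < 3\<close> is all that is asked for.
\<close>

section \<open>Rodrigues' formula and Legendre's differential equation\<close>

lemma power_dvd_higher_pderiv:
  fixes w p :: "real poly"
  assumes "w ^ n dvd p" "k \<le> n"
  shows "w ^ (n - k) dvd (pderiv ^^ k) p"
  using assms(2)
proof (induction k)
  case 0
  then show ?case using assms(1) by simp
next
  case (Suc k)
  define j where "j = n - Suc k"
  have nk: "n - k = Suc j" using Suc.prems by (simp add: j_def)
  obtain q where "(pderiv ^^ k) p = w ^ Suc j * q"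
    using Suc by (auto simp: nk elim: dvdE)
  then have "(pderiv ^^ Suc k) p = w ^ Suc j * pderiv q + q * (smult (of_nat (Suc j)) (w ^ j) * pderiv w)"
    by (simp only: funpow.simps o_apply pderiv_mult pderiv_power_Suc)
  also have "\<dots> = w ^ j * (w * pderiv q + smult (of_nat (Suc j)) (q * pderiv w))"
    by (simp add: algebra_simps)
  finally show ?case by (simp add: j_def)
qed

lemma higher_pderiv_X_mult:
  "(pderiv ^^ Suc n) ([:0, 1:] * f) =
     [:0, 1:] * (pderiv ^^ Suc n) f + smult (of_nat (Suc n)) ((pderiv ^^ n) (f :: real poly))"
proof (induction n)
  case 0
  show ?case by (simp add: pderiv_mult pderiv_pCons)
next
  case (Suc n)
  have "(pderiv ^^ Suc (Suc n)) ([:0, 1:] * f) = pderiv ((pderiv ^^ Suc n) ([:0, 1:] * f))" by simp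
  also have "\<dots> = pderiv ([:0, 1:] * (pderiv ^^ Suc n) f + smult (of_nat (Suc n)) ((pderiv ^^ n) f))"
    by (simp only: Suc.IH)
  finally show ?case
    by (simp only: poly_eq_poly_eq_iff[symmetric] fun_eq_iff)
       (simp add: pderiv_add pderiv_smult pderiv_pCons algebra_simps)
qed

text \<open>
  The Leibniz rule for the factor \<open>x\<^sup>2 - 1\<close>, whose third derivative vanishes.  It is stated for a product with
  \<open>pderiv v\<close> so that no derivative of order \<open>n - 1\<close> appears on the right.
\<close>

lemma higher_pderiv_legendre_base_mult_pderiv:
  fixes v :: "real poly"
  shows "(pderiv ^^ Suc n) ([:-1, 0, 1:] * pderiv v) =
     [:-1, 0, 1:] * pderiv (pderiv ((pderiv ^^ n) v))
       + smult (2 * of_nat (Suc n)) ([:0, 1:] * pderiv ((pderiv ^^ n) v))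
       + smult (of_nat n * of_nat (Suc n)) ((pderiv ^^ n) v)"
proof (induction n)
  case 0
  show ?case
    by (simp only: poly_eq_poly_eq_iff[symmetric] fun_eq_iff)
       (simp add: pderiv_pCons pderiv_add pderiv_diff algebra_simps)
next
  case (Suc n)
  have "(pderiv ^^ Suc (Suc n)) ([:-1, 0, 1:] * pderiv v) =
     pderiv ((pderiv ^^ Suc n) ([:-1, 0, 1:] * pderiv v))" by simp
  also have "\<dots> = pderiv ([:-1, 0, 1:] * pderiv (pderiv ((pderiv ^^ n) v))
       + smult (2 * of_nat (Suc n)) ([:0, 1:] * pderiv ((pderiv ^^ n) v))
       + smult (of_nat n * of_nat (Suc n)) ((pderiv ^^ n) v))"
    by (simp only: Suc.IH)
  finally show ?case
    by (simp only: poly_eq_poly_eq_iff[symmetric] fun_eq_iff)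
       (simp add: pderiv_add pderiv_diff pderiv_smult pderiv_mult pderiv_pCons algebra_simps)
qed

lemma pderiv_legendre_base_power:
  "pderiv ([:-1, 0, 1:] ^ Suc n) = smult (2 * real (Suc n)) ([:0, 1:] * [:-1, 0, 1:] ^ n)"
proof -
  have "pderiv [:-1, 0, 1::real:] = smult 2 [:0, 1:]"
    by (simp add: pderiv_pCons)
  then show ?thesis
    by (simp only: pderiv_power_Suc mult_smult_left mult_smult_right smult_smult mult.commute)
qed

text \<open>
  The power \<open>v = (x\<^sup>2 - 1) ^ n\<close> solves the first-order equation \<open>(x\<^sup>2 - 1) v' = 2 n x v\<close>.  Differentiating it
  \<open>n + 1\<close> times gives Legendre's equation for the \<open>n\<close>-th derivative of \<open>v\<close>.
\<close>

lemma legendre_ode: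
  "(1 - x\<^sup>2) * poly (pderiv (pderiv (legendre n))) x - 2 * x * poly (pderiv (legendre n)) x
     + real n * (real n + 1) * poly (legendre n) x = 0"
proof -
  define v where "v = ([:-1, 0, 1:] :: real poly) ^ n"
  define y where "y = (pderiv ^^ n) v"
  have v': "[:-1, 0, 1:] * pderiv v = smult (2 * real n) ([:0, 1:] * v)"
  proof (cases n)
    case 0
    then show ?thesis by (simp add: v_def)
  next
    case (Suc m)
    have "[:-1, 0, 1:] * pderiv v = smult (2 * real n) ([:0, 1:] * ([:-1, 0, 1:] * [:-1, 0, 1:] ^ m))"
      unfolding v_def Suc pderiv_legendre_base_power
      by (simp only: mult_smult_right mult.left_commute)
    then show ?thesis by (simp only: v_def Suc power_Suc)
  qed
  have "[:-1, 0, 1:] * pderiv (pderiv y) + smult (2 * real (Suc n)) ([:0, 1:] * pderiv y)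
          + smult (of_nat n * of_nat (Suc n)) y
      = smult (2 * real n) ([:0, 1:] * pderiv y + smult (of_nat (Suc n)) y)"
    using higher_pderiv_legendre_base_mult_pderiv[of n v] higher_pderiv_X_mult[of n v]
    by (simp only: v' y_def higher_pderiv_smult pderiv_smult funpow.simps o_apply)
  from arg_cong[OF this, of "\<lambda>p. poly p x"]
  have "(1 - x\<^sup>2) * poly (pderiv (pderiv y)) x - 2 * x * poly (pderiv y) x + real n * (real n + 1) * poly y x = 0"
    by (simp add: algebra_simps power2_eq_square)
  moreover obtain c where "legendre n = smult c y"
    by (simp add: legendre_def y_def v_def)
  then have "(1 - x\<^sup>2) * poly (pderiv (pderiv (legendre n))) x - 2 * x * poly (pderiv (legendre n)) x
      + real n * (real n + 1) * poly (legendre n) x =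
    c * ((1 - x\<^sup>2) * poly (pderiv (pderiv y)) x - 2 * x * poly (pderiv y) x + real n * (real n + 1) * poly y x)"
    by (simp add: pderiv_smult algebra_simps)
  ultimately show ?thesis by (simp only: mult_zero_right)
qed

text \<open>
  Since the derivative of \<open>(x\<^sup>2 - 1) ^ (n + 1)\<close> is \<open>2 (n + 1) x (x\<^sup>2 - 1) ^ n\<close>, the polynomial of degree
  \<open>n + 1\<close> equals \<open>x\<close> times the polynomial of degree \<open>n\<close> plus a multiple of the derivative of order
  \<open>n - 1\<close> of \<open>(x\<^sup>2 - 1) ^ n\<close>.  The latter still contains the factor \<open>x\<^sup>2 - 1\<close>.
\<close>

lemma legendre_endpoint:
  assumes "x\<^sup>2 = 1"
  shows "poly (legendre n) x = x ^ n"
proof (induction n)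
  case 0
  show ?case by (simp add: legendre_def)
next
  case (Suc n)
  let ?w = "[:-1, 0, 1:] :: real poly"
  have "poly ((pderiv ^^ n) ([:0, 1:] * ?w ^ n)) x = x * poly ((pderiv ^^ n) (?w ^ n)) x"
  proof (cases n)
    case 0
    then show ?thesis by simp
  next
    case (Suc m)
    have "?w dvd (pderiv ^^ m) (?w ^ n)"
      using power_dvd_higher_pderiv[of ?w n "?w ^ n" m] Suc by simp
    then have "poly ((pderiv ^^ m) (?w ^ n)) x = 0"
      using assms by (auto elim!: dvdE simp: power2_eq_square)
    then show ?thesis
      using higher_pderiv_X_mult[of m "?w ^ n"] Suc by simp
  qed
  moreover have "(pderiv ^^ Suc n) (?w ^ Suc n) = smult (2 * real (Suc n)) ((pderiv ^^ n) ([:0, 1:] * ?w ^ n))"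
    by (simp only: funpow_Suc_right o_apply pderiv_legendre_base_power higher_pderiv_smult)
  ultimately have "poly (legendre (Suc n)) x = x * poly (legendre n) x"
    by (simp add: legendre_def field_simps del: funpow.simps power_Suc of_nat_Suc)
       (simp add: field_simps del: funpow.simps)
  then show ?case using Suc.IH by simp
qed

section \<open>The norm of the Legendre polynomials\<close>

lemma integral_poly_by_parts:
  fixes p q :: "real poly"
  shows "(LINT t:{-1..1}|lborel. poly (pderiv p * q) t) =
     poly (p * q) 1 - poly (p * q) (-1) - (LINT t:{-1..1}|lborel. poly (p * pderiv q) t)"
  using integral_by_parts'[of "-1" 1 "poly (pderiv q)" "poly (pderiv p)" "poly q" "poly p"]
  by (simp add: set_lebesgue_integral_def poly_isCont mult.commute)

text \<open>
  Integrating by parts \<open>n\<close> times moves all derivatives of Rodrigues' formula onto \<open>q\<close>.  The boundary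
  terms vanish because the derivatives of order less than \<open>n\<close> of \<open>(x\<^sup>2 - 1) ^ n\<close> vanish at \<open>\<plusminus>1\<close>.
\<close>

lemma legendre_orthogonal:
  assumes "(pderiv ^^ n) q = 0"
  shows "(LINT t:{-1..1}|lborel. poly (legendre n * q) t) = 0"
proof -
  let ?w = "[:-1, 0, 1:] :: real poly"
  have "(LINT t:{-1..1}|lborel. poly ((pderiv ^^ k) (?w ^ n) * q) t) = 0"
    if "k \<le> n" "(pderiv ^^ k) q = 0" for k q
    using that
  proof (induction k arbitrary: q)
    case 0
    then show ?case by simp
  next
    case (Suc k)
    have "?w ^ (n - k) dvd (pderiv ^^ k) (?w ^ n)"
      using power_dvd_higher_pderiv[of ?w n "?w ^ n" k] Suc.prems(1) by simp
    moreover have "?w dvd ?w ^ (n - k)" using Suc.prems(1) by (simp add: dvd_power)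
    ultimately have "?w dvd (pderiv ^^ k) (?w ^ n)" using dvd_trans by blast
    then have "poly ((pderiv ^^ k) (?w ^ n)) 1 = 0" "poly ((pderiv ^^ k) (?w ^ n)) (-1) = 0"
      by (auto elim!: dvdE)
    moreover have "(LINT t:{-1..1}|lborel. poly ((pderiv ^^ k) (?w ^ n) * pderiv q) t) = 0"
      using Suc.prems by (intro Suc.IH) (simp_all add: funpow_swap1)
    ultimately show ?case
      using integral_poly_by_parts[of "(pderiv ^^ k) (?w ^ n)" q] by simp
  qed
  from this[OF order_refl assms] show ?thesis
    by (simp add: legendre_def mult.assoc set_lebesgue_integral_def mult.left_commute)
qed

lemma degree_legendre_le: "degree (legendre n) \<le> n"
  using degree_power_le[of "[:-1, 0, 1:] :: real poly" n]
  by (simp add: legendre_def degree_higher_pderiv)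

text \<open>
  The norm follows from two evaluations of the integral of \<open>x (P\<^sup>2)'\<close>.  Integration by parts and \<open>P(\<plusminus>1)\<^sup>2 = 1\<close>
  give \<open>2 - \<integral> P\<^sup>2\<close>.  On the other hand \<open>x (P\<^sup>2)' = 2 P (x P')\<close>, and \<open>x P' - n P\<close> has degree less than
  \<open>n\<close>, so by orthogonality the integral is \<open>2 n \<integral> P\<^sup>2\<close>.
\<close>

lemma integral_legendre_square:
  "(LINT t:{-1..1}|lborel. (poly (legendre n) t)\<^sup>2) = 2 / (2 * n + 1)"
proof -
  let ?P = "legendre n" and ?I = "\<lambda>p. LINT t:{-1..1}|lborel. poly p t"
  have lin: "?I (p + smult c q) = ?I p + c * ?I q" for p q :: "real poly" and c
  proof -
    have "set_integrable lborel {-1..1} (poly r)" for r :: "real poly"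
      by (intro borel_integrable_atLeastAtMost' continuous_intros)
    from set_integral_add(2)[OF this[of p] this[of "smult c q"]] show ?thesis
      by simp
  qed
  have "(pderiv ^^ n) ([:0, 1:] * pderiv ?P - smult (of_nat n) ?P) = 0"
  proof (rule poly_eqI)
    fix m
    have "coeff ([:0, 1:] * pderiv ?P - smult (of_nat n) ?P) (m + n) = m * coeff ?P (m + n)"
    proof -
      have "coeff ([:0, 1:] * pderiv ?P) k = k * coeff ?P k" for k
        by (cases k) (simp_all add: coeff_pderiv)
      then show ?thesis
        by (simp only: coeff_diff coeff_smult) (simp add: algebra_simps)
    qed
    also have "\<dots> = 0"
      using degree_legendre_le[of n] by (cases m) (auto intro: coeff_eq_0)
    finally show "coeff ((pderiv ^^ n) ([:0, 1:] * pderiv ?P - smult (of_nat n) ?P)) m = coeff 0 m"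
      by (simp only: coeff_higher_pderiv) simp
  qed
  then have "?I (?P * ([:0, 1:] * pderiv ?P - smult (of_nat n) ?P)) = 0"
    by (rule legendre_orthogonal)
  also have "?P * ([:0, 1:] * pderiv ?P - smult (of_nat n) ?P) =
      ?P * ([:0, 1:] * pderiv ?P) + smult (- of_nat n) (?P * ?P)"
    by (simp add: algebra_simps)
  finally have 1: "?I (?P * ([:0, 1:] * pderiv ?P)) = n * ?I (?P * ?P)"
    by (simp only: lin)
  have "?I (?P * ?P) = ?I (pderiv [:0, 1:] * (?P * ?P))"
    by (simp add: pderiv_pCons)
  also have "\<dots> = 2 - ?I ([:0, 1:] * pderiv (?P * ?P))"
    by (subst integral_poly_by_parts)
       (simp add: legendre_endpoint flip: power_add mult_2)
  also have "[:0, 1:] * pderiv (?P * ?P) = 0 + smult 2 (?P * ([:0, 1:] * pderiv ?P))"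
    by (simp only: poly_eq_poly_eq_iff[symmetric] fun_eq_iff) (simp add: pderiv_mult algebra_simps)
  also have "?I \<dots> = 2 * (n * ?I (?P * ?P))"
    by (simp only: lin 1) (simp add: set_lebesgue_integral_def)
  finally have "?I (?P * ?P) * (2 * n + 1) = 2" by (simp add: algebra_simps)
  then show ?thesis by (simp add: field_simps power2_eq_square)
qed

lemma legendre_on_square:
  "(legendre_on n x)\<^sup>2 = real (2 * n + 1) * (poly (legendre n) x)\<^sup>2"
proof -
  have "(LINT t:{-1..1}|lborel. (poly (legendre n) t)\<^sup>2 * (1 / 2)) = 1 / (2 * n + 1)"
    using integral_legendre_square[of n] by (simp add: field_simps)
  then show ?thesis
    unfolding legendre_on_def by (simp add: power_divide)
qed

section \<open>Sonin's monotone majorant\<close>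

text \<open>
  This is \<open>u\<^sup>2 + u'\<^sup>2 / q\<close> for \<open>u(\<theta>) = sqrt (sin \<theta>) P(cos \<theta>)\<close> and \<open>q = (n + 1/2)\<^sup>2 + 1 / (4 sin\<^sup>2 \<theta>)\<close>, the
  derivative being taken in \<open>\<theta>\<close>, rewritten in the variable \<open>x = cos \<theta>\<close>.
\<close>

definition sonin :: "nat \<Rightarrow> real \<Rightarrow> real" where
  "sonin n x = sqrt (1 - x\<^sup>2) * ((poly (legendre n) x)\<^sup>2 +
     (2 * (1 - x\<^sup>2) * poly (pderiv (legendre n)) x - x * poly (legendre n) x)\<^sup>2 /
     ((2 * n + 1)\<^sup>2 * (1 - x\<^sup>2) + 1))"

text \<open>
  In the variable \<open>\<theta>\<close> the derivative is \<open>2 u u' + 2 u' u'' / q - q' u'\<^sup>2 / q\<^sup>2\<close>, where the first two terms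
  cancel because \<open>u'' = - q u\<close>.  In the variable \<open>x\<close> this is a square with a factor of the sign of \<open>- x\<close>.
\<close>

lemma DERIV_sonin:
  assumes "\<bar>x\<bar> < 1"
  shows "(sonin n has_real_derivative
     - 2 * x * (2 * (1 - x\<^sup>2) * poly (pderiv (legendre n)) x - x * poly (legendre n) x)\<^sup>2 /
       (sqrt (1 - x\<^sup>2) * ((2 * n + 1)\<^sup>2 * (1 - x\<^sup>2) + 1)\<^sup>2)) (at x)"
proof -
  define y y' y'' where "y = poly (legendre n) x" and "y' = poly (pderiv (legendre n)) x"
    and "y'' = poly (pderiv (pderiv (legendre n))) x"
  define s g N d where "s = 1 - x\<^sup>2" and "g = 2 * s * y' - x * y" and "N = (2 * real n + 1)\<^sup>2"
    and "d = N * s + 1"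
  have x2: "x\<^sup>2 < 1" using assms by (simp add: abs_square_less_1)
  have s: "s > 0" using x2 by (simp add: s_def)
  then have d: "d > 0" by (simp add: d_def N_def add_nonneg_pos)
  have ode: "2 * s * y'' = 4 * x * y' - (N - 1) / 2 * y"
    using legendre_ode[of x n]
    by (simp add: s_def N_def y_def y'_def y''_def power2_eq_square field_simps)
  have g': "2 * s * y'' - 4 * x * y' - y - x * y' = - ((N + 1) / 2 * y + x * y')"
    using ode by (simp add: field_simps)
  have Ds: "((\<lambda>t. 1 - t\<^sup>2) has_real_derivative - 2 * x) (at x)"
    by (auto intro!: derivative_eq_intros)
  have Dr: "((\<lambda>t. sqrt (1 - t\<^sup>2)) has_real_derivative - x / sqrt s) (at x)"
    by (rule DERIV_chain'[OF Ds, THEN DERIV_cong, OF DERIV_real_sqrt])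
       (use s in \<open>simp_all add: s_def field_simps\<close>)
  have Dg: "((\<lambda>t. 2 * (1 - t\<^sup>2) * poly (pderiv (legendre n)) t - t * poly (legendre n) t)
      has_real_derivative 2 * s * y'' - 4 * x * y' - y - x * y') (at x)"
    by (rule DERIV_cong[OF DERIV_diff[OF DERIV_mult[OF DERIV_cmult[OF Ds] poly_DERIV]
          DERIV_mult[OF DERIV_ident poly_DERIV]]])
       (simp add: s_def y_def y'_def y''_def algebra_simps)
  have Dd: "((\<lambda>t. (2 * real n + 1)\<^sup>2 * (1 - t\<^sup>2) + 1) has_real_derivative N * (- 2 * x)) (at x)"
    unfolding N_def by (rule DERIV_cong[OF DERIV_add[OF DERIV_cmult[OF Ds] DERIV_const]]) simp
  have "(sonin n has_real_derivative
     (- x / sqrt s) * (y\<^sup>2 + g\<^sup>2 / d) + sqrt s * (2 * y * y' +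
        (2 * g * (2 * s * y'' - 4 * x * y' - y - x * y') * d + g\<^sup>2 * (2 * N * x)) / d\<^sup>2)) (at x)"
    unfolding sonin_def[abs_def]
    by (rule DERIV_cong[OF DERIV_mult[OF Dr DERIV_add[OF DERIV_power[OF poly_DERIV, where n = 2]
            DERIV_divide[OF DERIV_power[OF Dg, where n = 2] Dd]]]])
       (simp_all only: s_def[symmetric] y_def[symmetric] y'_def[symmetric] N_def[symmetric]
          g_def[symmetric] d_def[symmetric], use d in \<open>simp_all add: power2_eq_square algebra_simps\<close>)
  also have "(- x / sqrt s) * (y\<^sup>2 + g\<^sup>2 / d) + sqrt s * (2 * y * y' +
        (2 * g * (2 * s * y'' - 4 * x * y' - y - x * y') * d + g\<^sup>2 * (2 * N * x)) / d\<^sup>2) =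
      (- x * (y\<^sup>2 + g\<^sup>2 / d) + s * (2 * y * y' +
        (- 2 * g * ((N + 1) / 2 * y + x * y') * d + g\<^sup>2 * (2 * N * x)) / d\<^sup>2)) / sqrt s"
  proof -
    have rr: "sqrt s * (sqrt s * z) = s * z" for z
      using s by (simp flip: mult.assoc)
    then show ?thesis using s d unfolding g' by (simp add: field_simps rr)
  qed
  also have "\<dots> = - 2 * x * g\<^sup>2 / (sqrt s * d\<^sup>2)"
  proof -
    have "(- x * (y\<^sup>2 + g\<^sup>2 / d) + s * (2 * y * y' +
        (- 2 * g * ((N + 1) / 2 * y + x * y') * d + g\<^sup>2 * (2 * N * x)) / d\<^sup>2)) =
        (- x * (y\<^sup>2 + g\<^sup>2 / d) + (2 * s * y') * y + (- g * (2 * s * ((N + 1) / 2 * y + x * y')) * d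
           + 2 * x * g\<^sup>2 * (N * s)) / d\<^sup>2)"
      by (simp add: field_simps)
    \<comment> \<open>Everything is now expressed through \<open>x\<close>, \<open>y\<close>, \<open>g\<close> and \<open>d\<close>, after which the terms
      that contain \<open>y\<close> cancel.\<close>
    also have "2 * s * ((N + 1) / 2 * y + x * y') = d * y + x * g"
      by (simp add: d_def g_def s_def field_simps power2_eq_square)
    also have "2 * s * y' = g + x * y"
      by (simp add: g_def)
    also have "N * s = d - 1"
      by (simp add: d_def)
    also have "- x * (y\<^sup>2 + g\<^sup>2 / d) + (g + x * y) * y + (- g * (d * y + x * g) * d
        + 2 * x * g\<^sup>2 * (d - 1)) / d\<^sup>2 = - 2 * x * g\<^sup>2 / d\<^sup>2"
      using d by (simp add: field_simps power2_eq_square)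
    finally have eq: "- x * (y\<^sup>2 + g\<^sup>2 / d) + s * (2 * y * y' +
        (- 2 * g * ((N + 1) / 2 * y + x * y') * d + g\<^sup>2 * (2 * N * x)) / d\<^sup>2) = - 2 * x * g\<^sup>2 / d\<^sup>2" .
    show ?thesis unfolding eq by simp
  qed
  finally show ?thesis
    by (simp add: g_def d_def N_def s_def y_def y'_def)
qed

lemma sonin_le_sonin_0:
  assumes "\<bar>x\<bar> < 1"
  shows "sonin n x \<le> sonin n 0"
proof (cases "x \<ge> 0")
  case True
  show ?thesis
  proof (rule DERIV_nonpos_imp_nonincreasing[where f = "sonin n", OF True])
    fix t assume "0 \<le> t" "t \<le> x"
    then have t: "\<bar>t\<bar> < 1" "t \<ge> 0" "t\<^sup>2 < 1" using assms by (auto simp: abs_square_less_1)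
    show "\<exists>y. (sonin n has_real_derivative y) (at t) \<and> y \<le> 0"
      by (rule exI, rule conjI, rule DERIV_sonin[OF t(1)])
        (use t in \<open>auto intro!: divide_nonpos_nonneg mult_nonneg_nonneg\<close>)
  qed
next
  case False
  show ?thesis
  proof (rule DERIV_nonneg_imp_nondecreasing[where f = "sonin n"])
    fix t assume "x \<le> t" "t \<le> 0"
    then have t: "\<bar>t\<bar> < 1" "t \<le> 0" "t\<^sup>2 < 1" using assms by (auto simp: abs_square_less_1)
    show "\<exists>y. (sonin n has_real_derivative y) (at t) \<and> 0 \<le> y"
      by (rule exI, rule conjI, rule DERIV_sonin[OF t(1)])
        (rule divide_nonneg_nonneg, rule mult_nonneg_nonneg, use t in simp_all)
  qed (use False in simp)
qed

section \<open>The value of the majorant at the origin\<close>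

lemma coeff_legendre_base_power:
  "coeff ([:-1, 0, 1:] ^ n) (2 * m) = (- 1) ^ (n + m) * real (n choose m)"
  "coeff ([:-1, 0, 1 :: real:] ^ n) (Suc (2 * m)) = 0"
proof (induction n arbitrary: m)
  case 0
  { case 1 show ?case by (cases m) simp_all }
  { case 2 show ?case by (simp add: coeff_pCons) }
next
  case (Suc n)
  note IH = Suc.IH
  have rec: "coeff ([:-1, 0, 1 :: real:] ^ Suc n) (Suc (Suc k)) =
      coeff ([:-1, 0, 1:] ^ n) k - coeff ([:-1, 0, 1:] ^ n) (Suc (Suc k))" for k
    by (simp add: coeff_pCons)
  { case 1
    show ?case
    proof (cases m)
      case 0
      then show ?thesis using IH(1)[of 0] by simp
    next
      case (Suc l)
      have "coeff ([:-1, 0, 1 :: real:] ^ Suc n) (2 * m) =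
          (- 1) ^ (n + l) * real (n choose l) - (- 1) ^ (n + Suc l) * real (n choose Suc l)"
        using rec[of "2 * l"] IH(1)[of l] IH(1)[of "Suc l"] Suc by simp
      then show ?thesis by (simp add: Suc algebra_simps)
    qed }
  { case 2
    show ?case
    proof (cases m)
      case 0
      then show ?thesis using IH(2)[of 0] by (simp add: coeff_pCons)
    next
      case (Suc l)
      then show ?thesis using rec[of "Suc (2 * l)"] IH(2)[of l] IH(2)[of "Suc l"] by simp
    qed }
qed

definition central_ratio :: "nat \<Rightarrow> real" where
  "central_ratio m = real ((2 * m) choose m) / 4 ^ m"

lemma central_binomial_Suc: "(2 * Suc m) choose Suc m = 2 * ((2 * m + 1) choose Suc m)"
  using binomial_symmetric[of m "2 * m + 1"] by simp

text \<open>
  The ratio of consecutive terms is \<open>(2m + 1) / (2m + 2)\<close>, and the induction step is the inequality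
  \<open>(2m + 1)\<^sup>2 (3m + 4) \<le> (2m + 2)\<^sup>2 (3m + 1)\<close>, whose sides differ by exactly \<open>m\<close>.
\<close>

lemma central_ratio_square_le: "(central_ratio m)\<^sup>2 \<le> 1 / real (3 * m + 1)"
proof (induction m)
  case 0
  show ?case by (simp add: central_ratio_def)
next
  case (Suc m)
  have "Suc m * ((2 * Suc m) choose Suc m) = 2 * ((2 * m + 1) * ((2 * m) choose m))"
    using Suc_times_binomial_eq[of "2 * m" m]
    unfolding central_binomial_Suc by (simp only: Suc_eq_plus1 mult_ac)
  then have "real (Suc m) * real ((2 * Suc m) choose Suc m) = 2 * (2 * m + 1) * real ((2 * m) choose m)"
    by (simp only: of_nat_mult[symmetric] mult.assoc)
  moreover have "a = 2 * (2 * m + 1) * b / Suc m" if "real (Suc m) * a = 2 * (2 * m + 1) * b" for a b :: real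
    using that by (simp add: field_simps)
  ultimately have "real ((2 * Suc m) choose Suc m) = 2 * (2 * m + 1) * real ((2 * m) choose m) / Suc m"
    by blast
  then have "central_ratio (Suc m) = central_ratio m * ((2 * m + 1) / (2 * real (Suc m)))"
    by (simp only: central_ratio_def) (simp add: divide_simps del: of_nat_Suc, simp)
  then have "(central_ratio (Suc m))\<^sup>2 = (central_ratio m)\<^sup>2 * ((2 * m + 1) / (2 * real (Suc m)))\<^sup>2"
    by (simp only: power_mult_distrib)
  also have "\<dots> \<le> 1 / real (3 * m + 1) * ((2 * m + 1) / (2 * real (Suc m)))\<^sup>2"
    by (intro mult_right_mono Suc.IH) simp
  also have "\<dots> \<le> 1 / real (3 * Suc m + 1)"
  proof -
    have "1 / a * (b / c)\<^sup>2 \<le> 1 / d" if "d * b\<^sup>2 \<le> a * c\<^sup>2" "a > 0" "c > 0" "d > 0" for a b c d :: real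
      using that by (simp add: field_simps)
    from this[of "real (3 * Suc m + 1)" "2 * m + 1" "real (3 * m + 1)" "2 * real (Suc m)"] show ?thesis
      by (simp_all add: power2_eq_square algebra_simps)
  qed
  finally show ?case .
qed

lemma legendre_at_0:
  "poly (legendre (2 * m)) 0 = (- 1) ^ m * central_ratio m"
  "poly (legendre (2 * m + 1)) 0 = 0"
  "poly (pderiv (legendre (2 * m))) 0 = 0"
  "poly (pderiv (legendre (2 * m + 1))) 0 = (- 1) ^ m * (2 * real m + 2) * central_ratio (Suc m)"
proof -
  have 0: "poly (legendre n) 0 = coeff ([:-1, 0, 1:] ^ n) n / 2 ^ n" for n
    by (simp add: legendre_def poly_0_coeff_0 coeff_higher_pderiv pochhammer_fact[symmetric])
  have 1: "poly (pderiv (legendre n)) 0 = (n + 1) * coeff ([:-1, 0, 1:] ^ n) (Suc n) / 2 ^ n" for n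
    using coeff_higher_pderiv[of "Suc n" "[:-1, 0, 1::real:] ^ n" 0] fact_Suc[of n, where 'a=real]
    by (simp add: legendre_def poly_0_coeff_0 pderiv_smult pochhammer_fact[symmetric])
  show "poly (legendre (2 * m)) 0 = (- 1) ^ m * central_ratio m"
    by (simp only: 0 coeff_legendre_base_power(1) central_ratio_def) (simp add: power_add power_mult)
  show "poly (legendre (2 * m + 1)) 0 = 0"
    using coeff_legendre_base_power(2)[of "2 * m + 1" m] by (simp only: 0 Suc_eq_plus1 div_0)
  show "poly (pderiv (legendre (2 * m))) 0 = 0"
    by (simp add: 1 coeff_legendre_base_power)
  show "poly (pderiv (legendre (2 * m + 1))) 0 = (- 1) ^ m * (2 * real m + 2) * central_ratio (Suc m)"
  proof -
    have "Suc (2 * m + 1) = 2 * Suc m" by simp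
    moreover have "(- 1) ^ (2 * m + 1 + Suc m) = (- 1 :: real) ^ m"
      by (simp add: power_add power_mult)
    moreover have "2 ^ (2 * m + 1) = (2 * 4 ^ m :: real)"
      by (simp add: power_mult)
    ultimately show ?thesis
      by (simp only: 1 coeff_legendre_base_power(1) central_ratio_def central_binomial_Suc)
        (simp add: field_simps del: binomial_Suc_Suc)
  qed
qed

text \<open>
  For even \<open>n\<close> only the value \<open>P(0)\<close> contributes, for odd \<open>n\<close> only \<open>P'(0)\<close>.  With the bound on the
  central binomial coefficients both cases reduce to an inequality between rational functions of \<open>m\<close>,
  which tend to \<open>4 / 3\<close>.
\<close>

lemma sonin_0_le: "real (2 * n + 1) * sonin n 0 \<le> 3 / 2"
proof -
  have sq1: "((- 1 :: real) ^ m)\<^sup>2 = 1" for m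
    by (simp add: power2_eq_square flip: power_mult_distrib)
  show ?thesis
  proof (cases "even n")
    case True
    then obtain m where m: "n = 2 * m" by blast
    have "real (2 * n + 1) * sonin n 0 = (4 * m + 1) * (central_ratio m)\<^sup>2"
      using legendre_at_0[of m] sq1 by (simp add: m sonin_def power_mult_distrib)
    also have "\<dots> \<le> (4 * m + 1) * (1 / real (3 * m + 1))"
      by (intro mult_left_mono central_ratio_square_le) simp
    also have "\<dots> \<le> 3 / 2"
      by (simp add: field_simps)
    finally show ?thesis .
  next
    case False
    then obtain m where m: "n = 2 * m + 1" using oddE by blast
    define c where "c = (4 * real m + 3) * 4 * (2 * m + 2)\<^sup>2 / ((4 * m + 3)\<^sup>2 + 1)"
    have "real (2 * n + 1) * sonin n 0 = c * (central_ratio (Suc m))\<^sup>2"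
    proof -
      have "(poly (pderiv (legendre (2 * m + 1))) 0)\<^sup>2 = (2 * real m + 2)\<^sup>2 * (central_ratio (Suc m))\<^sup>2"
        by (simp only: legendre_at_0(4) power_mult_distrib sq1 mult_1_left)
      moreover have "sonin n 0 = 4 * (poly (pderiv (legendre (2 * m + 1))) 0)\<^sup>2 / ((4 * m + 3)\<^sup>2 + 1)"
        using legendre_at_0(2)[of m] by (simp add: m sonin_def power_mult_distrib)
      ultimately show ?thesis
        by (simp add: m c_def) (simp add: power2_eq_square algebra_simps)
    qed
    also have "\<dots> \<le> c * (1 / real (3 * Suc m + 1))"
      by (intro mult_left_mono central_ratio_square_le) (simp add: c_def)
    also have "\<dots> \<le> 3 / 2"
    proof -
      have "(4 * real m + 3) * 4 * (2 * m + 2)\<^sup>2 * 2 \<le> 3 * (3 * Suc m + 1) * ((4 * m + 3)\<^sup>2 + 1)"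
        by (simp add: power2_eq_square algebra_simps)
      moreover have "((4 * real m + 3)\<^sup>2 + 1) > 0" by (simp add: add_nonneg_pos)
      ultimately show ?thesis unfolding c_def by (simp add: divide_simps) (simp add: algebra_simps)
    qed
    finally show ?thesis .
  qed
qed

lemma legendre_on_Bernstein_bound:
  assumes "x \<in> {-1..1}"
  shows "sqrt (1 - x\<^sup>2) * (legendre_on n x)\<^sup>2 \<le> 3 / 2"
proof (cases "\<bar>x\<bar> = 1")
  case True
  then have "x\<^sup>2 = 1" by (simp add: abs_square_eq_1)
  then show ?thesis by simp
next
  case False
  with assms have x: "\<bar>x\<bar> < 1" by auto
  then have x2: "x\<^sup>2 < 1" by (simp add: abs_square_less_1)
  have "sqrt (1 - x\<^sup>2) * (poly (legendre n) x)\<^sup>2 \<le> sonin n x"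
    unfolding sonin_def using x2 by (intro mult_left_mono) auto
  also have "\<dots> \<le> sonin n 0" by (rule sonin_le_sonin_0[OF x])
  finally have "real (2 * n + 1) * (sqrt (1 - x\<^sup>2) * (poly (legendre n) x)\<^sup>2) \<le> real (2 * n + 1) * sonin n 0"
    by (intro mult_left_mono) auto
  also have "\<dots> \<le> 3 / 2" by (rule sonin_0_le)
  finally show ?thesis by (simp only: legendre_on_square mult.left_commute)
qed

section \<open>The weight function\<close>

text \<open>
  The cube enters through the support of the density; on its faces both sides are \<open>0\<close>, by
  \<open>0 powr a = 0\<close> on the left and by the open interval in the density on the right.
\<close>

lemma env_square:
  "indicator (hypercube :: (real ^ 'd::finite) set) \<xi> * (env \<xi>)\<^sup>2 = (\<Prod>i\<in>UNIV. pi * chebyshev_density (\<xi> $ i))"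
proof (cases "\<xi> \<in> hypercube")
  case True
  have "((1 - (\<xi> $ i)\<^sup>2) powr (- 1 / 4))\<^sup>2 = pi * chebyshev_density (\<xi> $ i)" for i
  proof -
    have x: "\<xi> $ i \<in> {-1..1}" using True by (simp add: hypercube_def)
    show ?thesis
    proof (cases "\<bar>\<xi> $ i\<bar> = 1")
      case True
      then show ?thesis by (auto simp: chebyshev_density_def abs_if split: if_splits)
    next
      case False
      with x have "\<bar>\<xi> $ i\<bar> < 1" by auto
      then have "(\<xi> $ i)\<^sup>2 < 1" and "\<xi> $ i \<in> {-1<..<1}" by (auto simp: abs_square_less_1)
      then show ?thesis
        by (simp add: chebyshev_density_def power2_eq_square powr_minus_divide powr_half_sqrt flip: powr_add)
    qed
  qed
  then show ?thesis using True by (simp add: env_def prod_power_distrib)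
next
  case False
  then obtain i where "\<xi> $ i \<notin> {-1..1}" by (auto simp: hypercube_def)
  then have "chebyshev_density (\<xi> $ i) = 0" by (auto simp: chebyshev_density_def)
  then have "(\<Prod>i\<in>UNIV. pi * chebyshev_density (\<xi> $ i)) = 0" by (intro prod_zero) auto
  then show ?thesis using False by simp
qed

lemma chebyshev_density_nonneg: "chebyshev_density x \<ge> 0"
  by (auto simp: chebyshev_density_def indicator_def abs_square_le_1 abs_if)

lemma borel_measurable_chebyshev_density [measurable]: "chebyshev_density \<in> borel_measurable borel"
  unfolding chebyshev_density_def[abs_def] by measurable

text \<open>
  By \<open>env_square\<close> the integrand is a product of functions of the single coordinates, and Lebesgue measure is
  a product measure.
\<close>

lemma integral_env_square:
  assumes "(\<integral>\<^sup>+x. chebyshev_density x \<partial>lborel) = 1"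
  shows "(LINT \<xi>:(hypercube :: (real ^ 'd::finite) set)|lborel. uniform_dens \<xi> * (env \<xi>)\<^sup>2) = (pi / 2) ^ CARD('d)"
proof -
  have b: "bij_betw (\<lambda>i. axis i 1) (UNIV :: 'd set) (Basis :: (real ^ 'd) set)"
    by (auto simp: bij_betw_def inj_on_def axis_eq_axis Basis_vec_def)
  have "(\<integral>\<^sup>+\<xi>. (\<Prod>i\<in>UNIV. ennreal (chebyshev_density (\<xi> $ i))) \<partial>(lborel :: (real ^ 'd) measure)) =
      (\<integral>\<^sup>+\<xi>. (\<Prod>b\<in>Basis. ennreal (chebyshev_density (\<xi> \<bullet> b))) \<partial>(lborel :: (real ^ 'd) measure))"
    by (intro nn_integral_cong)
      (simp add: prod.reindex_bij_betw[OF b, symmetric] cart_eq_inner_axis del: inner_axis)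
  also have "\<dots> = 1"
    by (subst nn_integral_lborel_prod) (simp_all add: assms)
  finally have "(\<integral>\<xi>. (\<Prod>i\<in>UNIV. chebyshev_density (\<xi> $ i)) \<partial>(lborel :: (real ^ 'd) measure)) = 1"
    by (subst integral_eq_nn_integral)
      (auto simp: prod_ennreal chebyshev_density_nonneg prod_nonneg)
  moreover have "indicator hypercube \<xi> *\<^sub>R (uniform_dens \<xi> * (env \<xi>)\<^sup>2) =
      (pi / 2) ^ CARD('d) * (\<Prod>i\<in>UNIV. chebyshev_density (\<xi> $ i))" for \<xi> :: "real ^ 'd"
  proof -
    have "indicator hypercube \<xi> *\<^sub>R (uniform_dens \<xi> * (env \<xi>)\<^sup>2) =
       uniform_dens \<xi> * (indicator hypercube \<xi> * (env \<xi>)\<^sup>2)" by simp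
    then show ?thesis
      by (simp only: env_square) (simp add: uniform_dens_def prod.distrib power_divide)
  qed
  ultimately show ?thesis
    by (simp add: set_lebesgue_integral_def)
qed

lemma weight_square:
  assumes "(\<integral>\<^sup>+x. chebyshev_density x \<partial>lborel) = 1" and "\<xi> \<in> hypercube"
  shows "(weight (\<xi> :: real ^ 'd::finite))\<^sup>2 = (\<Prod>i\<in>UNIV. pi / 2 * sqrt (1 - (\<xi> $ i)\<^sup>2))"
proof -
  have c: "(norm_const TYPE('d))\<^sup>2 = 1 / (pi / 2) ^ CARD('d)"
    unfolding norm_const_def integral_env_square[OF assms(1)]
    by (simp add: power2_eq_square powr_minus_divide flip: powr_add)
  have "inverse (pi * chebyshev_density x) = sqrt (1 - x\<^sup>2)" if "x \<in> {-1..1}" for x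
    using that by (cases "\<bar>x\<bar> = 1") (auto simp: chebyshev_density_def abs_if divide_simps split: if_splits)
  then have "inverse (\<Prod>i\<in>UNIV. pi * chebyshev_density (\<xi> $ i)) = (\<Prod>i\<in>UNIV. sqrt (1 - (\<xi> $ i)\<^sup>2))"
    using assms(2) unfolding hypercube_def prod_inversef[symmetric] o_def
    by (intro prod.cong) auto
  moreover have "(env \<xi>)\<^sup>2 = (\<Prod>i\<in>UNIV. pi * chebyshev_density (\<xi> $ i))"
    using env_square[of \<xi>] assms(2) by simp
  ultimately have "1 / (env \<xi>)\<^sup>2 = (\<Prod>i\<in>UNIV. sqrt (1 - (\<xi> $ i)\<^sup>2))"
    by (simp add: divide_inverse)
  moreover have "(weight \<xi>)\<^sup>2 = (1 / (norm_const TYPE('d))\<^sup>2) * (1 / (env \<xi>)\<^sup>2)"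
    by (simp add: weight_def power_mult_distrib power_divide)
  ultimately show ?thesis by (simp only: c prod.distrib prod_constant) simp
qed

section \<open>The coherence bound\<close>

theorem theorem4p4:
  fixes M :: "'a measure" and Y :: "'a \<Rightarrow> real ^ 'd::finite" and p :: nat
  assumes "prob_space M"
    and "chebyshev_distributed M Y"
    and "p \<ge> 1"
  shows "coherence (weight :: real ^ 'd \<Rightarrow> real) p \<le> 3 ^ CARD('d)"
proof -
  interpret prob_space M by fact
  have D: "distributed M lborel (\<lambda>\<omega>. Y \<omega> $ undefined) (\<lambda>x. ennreal (chebyshev_density x))"
    using assms(2) by (simp add: chebyshev_distributed_def)
  \<comment> \<open>All coordinates have the same density, so any one of them shows its total mass.\<close>
  have total: "(\<integral>\<^sup>+x. chebyshev_density x \<partial>lborel) = 1"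
    using distributed_nn_integral[OF D, of "\<lambda>_. 1"] by (simp add: emeasure_space_1)
  have "ereal (\<bar>weight \<xi> * legendre_multi k \<xi>\<bar>\<^sup>2) \<le> 3 ^ CARD('d)"
    if "\<xi> \<in> hypercube" for k and \<xi> :: "real ^ 'd"
  proof -
    have "\<bar>weight \<xi> * legendre_multi k \<xi>\<bar>\<^sup>2 =
        (\<Prod>i\<in>UNIV. pi / 2 * sqrt (1 - (\<xi> $ i)\<^sup>2)) * (\<Prod>i\<in>UNIV. (legendre_on (k $ i) (\<xi> $ i))\<^sup>2)"
      by (simp only: power2_abs power_mult_distrib weight_square[OF total that] legendre_multi_def prod_power_distrib)
    also have "\<dots> = (\<Prod>i\<in>UNIV. pi / 2 * (sqrt (1 - (\<xi> $ i)\<^sup>2) * (legendre_on (k $ i) (\<xi> $ i))\<^sup>2))"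
      by (simp only: prod.distrib mult.assoc)
    also have "\<dots> \<le> (\<Prod>i\<in>(UNIV :: 'd set). 3)"
    proof (intro prod_mono conjI)
      fix i
      have x: "\<xi> $ i \<in> {-1..1}" using that by (simp add: hypercube_def)
      then have "1 - (\<xi> $ i)\<^sup>2 \<ge> 0" by (auto simp: abs_square_le_1 abs_le_iff)
      then show "0 \<le> pi / 2 * (sqrt (1 - (\<xi> $ i)\<^sup>2) * (legendre_on (k $ i) (\<xi> $ i))\<^sup>2)" by simp
      have "pi / 2 * (sqrt (1 - (\<xi> $ i)\<^sup>2) * (legendre_on (k $ i) (\<xi> $ i))\<^sup>2) \<le> pi / 2 * (3 / 2)"
        by (intro mult_left_mono legendre_on_Bernstein_bound x) simp
      also have "\<dots> \<le> 3" using pi_less_4 by simp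
      finally show "pi / 2 * (sqrt (1 - (\<xi> $ i)\<^sup>2) * (legendre_on (k $ i) (\<xi> $ i))\<^sup>2) \<le> 3" .
    qed
    finally have "ereal (\<bar>weight \<xi> * legendre_multi k \<xi>\<bar>\<^sup>2) \<le> ereal (3 ^ CARD('d))" by simp
    also have "\<dots> = 3 ^ CARD('d)" by (simp flip: ereal_power)
    finally show ?thesis .
  qed
  then show ?thesis
    unfolding coherence_def by (intro SUP_least) auto
qed

end
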